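(* Let $X$ be a nonempty set and let $f\in T(X)$. Then $f$ is unit-regular in $T(X)$ if and only if $f$ is semi-balanced, i.e. $\mathrm{c}(f)=\mathrm{d}(f)$.
   Context: Maps are written to the right of their arguments and composed from left to right: $x(fg)=(xf)g$. $T(X)$ is the full transformation monoid of all maps $X\to X$ under composition; its group of units is the symmetric group $S(X)$. An element $x$ of a monoid $M$ is unit-regular in $M$ if there is a unit $u$ of $M$ with $xux=x$. For a map $f\colon X\to Y$, $\ker(f)=\{(x,y)\in X\times X\mid xf=yf\}$. A cross-section of an equivalence relation is a subset meeting each equivalence class in exactly one point; $T_f$ denotes any cross-section of $\ker(f)$. The collapse of $f$ is the cardinal $\mathrm{c}(f)=|X\setminus T_f|$ and the defect of $f$ is the cardinal $\mathrm{d}(f)=|Y\setminus Xf|$, where $Xf$ is the image of $f$. An element $f\in T(X)$ is semi-balanced if $\mathrm{c}(f)=\mathrm{d}(f)$. The set $X$ may be finite or infinite. *)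

theory Defs
  imports "HOL-Algebra.Bij"
begin

unbundle cardinal_syntax

text \<open>
  Maps from \<open>X\<close> to \<open>X\<close> are represented extensionally, i.e. with the value \<open>undefined\<close>
  outside \<open>X\<close>.  Maps compose from left to right, so \<open>f \<otimes> g\<close> applies \<open>f\<close> first.
\<close>

definition full_transf_monoid :: "'a set \<Rightarrow> ('a \<Rightarrow> 'a) monoid" where
  "full_transf_monoid X =
     \<lparr>carrier = X \<rightarrow>\<^sub>E X, mult = (\<lambda>f g. compose X g f), one = (\<lambda>x\<in>X. x)\<rparr>"

definition unit_regular :: "('a, 'm) monoid_scheme \<Rightarrow> 'a \<Rightarrow> bool" where
  "unit_regular M x \<longleftrightarrow> (\<exists>u\<in>Units M. x \<otimes>\<^bsub>M\<^esub> u \<otimes>\<^bsub>M\<^esub> x = x)"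

definition kernel_on :: "'a set \<Rightarrow> ('a \<Rightarrow> 'b) \<Rightarrow> ('a \<times> 'a) set" where
  "kernel_on X f = {(x, y). x \<in> X \<and> y \<in> X \<and> f x = f y}"

definition cross_section :: "'a set \<Rightarrow> ('a \<times> 'a) set \<Rightarrow> 'a set \<Rightarrow> bool" where
  "cross_section X r T \<longleftrightarrow> T \<subseteq> X \<and> (\<forall>C\<in>X // r. \<exists>!x. x \<in> T \<inter> C)"

text \<open>
  Cardinals are the cardinal orders \<open>|A|\<close> of the library; two of them denote the same
  cardinal iff they are related by \<open>=o\<close>.  The collapse is defined by choosing a cross-section;
  \<open>cross_section_kernel_ex\<close> and \<open>collapse_cross_section\<close> below show that one exists and that
  the cardinal does not depend on the choice.
\<close>

definition collapse :: "'a set \<Rightarrow> ('a \<Rightarrow> 'b) \<Rightarrow> 'a rel" where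
  "collapse X f = |X - (SOME T. cross_section X (kernel_on X f) T)|"

definition defect :: "'a set \<Rightarrow> 'b set \<Rightarrow> ('a \<Rightarrow> 'b) \<Rightarrow> 'b rel" where
  "defect X Y f = |Y - f ` X|"

definition semi_balanced :: "'a set \<Rightarrow> ('a \<Rightarrow> 'a) \<Rightarrow> bool" where
  "semi_balanced X f \<longleftrightarrow> collapse X f =o defect X X f"

lemma equiv_kernel_on: "equiv X (kernel_on X f)"
  by (rule equivI) (auto simp: kernel_on_def refl_on_def sym_def trans_def)

lemma cross_section_kernel_iff:
  "cross_section X (kernel_on X f) T \<longleftrightarrow> T \<subseteq> X \<and> (\<forall>x\<in>X. \<exists>!t. t \<in> T \<and> f t = f x)"
proof -
  have q: "X // kernel_on X f = (\<lambda>x. {y \<in> X. f y = f x}) ` X"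
  proof -
    have "kernel_on X f `` {x} = {y \<in> X. f y = f x}" if "x \<in> X" for x
      using that by (auto simp: kernel_on_def)
    then show ?thesis
      by (auto simp: quotient_def)
  qed
  have "(\<exists>!t. t \<in> T \<inter> {y \<in> X. f y = f x}) \<longleftrightarrow> (\<exists>!t. t \<in> T \<and> f t = f x)" if "T \<subseteq> X" for x
    by (rule arg_cong[where f = Ex1]) (use that in auto)
  then show ?thesis
    unfolding cross_section_def q ball_simps by (intro conj_cong ball_cong refl)
qed

lemma cross_section_kernel_ex: "\<exists>T. cross_section X (kernel_on X f) T"
proof -
  let ?T = "inv_into X f ` f ` X"
  have "\<exists>!t. t \<in> ?T \<and> f t = f x" if x: "x \<in> X" for x
  proof (rule ex1I)
    show "inv_into X f (f x) \<in> ?T \<and> f (inv_into X f (f x)) = f x"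
      using x by (simp add: f_inv_into_f)
  next
    fix t assume t: "t \<in> ?T \<and> f t = f x"
    then obtain y where "y \<in> X" "t = inv_into X f (f y)"
      by (elim conjE imageE) simp
    moreover from this have "f t = f y"
      by (simp add: f_inv_into_f)
    ultimately show "t = inv_into X f (f x)"
      using t by simp
  qed
  moreover have "?T \<subseteq> X"
    by (auto intro: inv_into_into)
  ultimately have "cross_section X (kernel_on X f) ?T"
    unfolding cross_section_kernel_iff by (intro conjI ballI)
  then show ?thesis ..
qed

lemma card_of_compl_cross_section:
  assumes T: "cross_section X (kernel_on X f) T" and U: "cross_section X (kernel_on X f) U"
  shows "|X - T| =o |X - U|"
proof -
  define t u where "t x = (THE t. t \<in> T \<and> f t = f x)" and "u x = (THE t. t \<in> U \<and> f t = f x)" for x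
  have t: "t x \<in> T" "f (t x) = f x" if "x \<in> X" for x
    using T that theI'[of "\<lambda>t. t \<in> T \<and> f t = f x"] unfolding cross_section_kernel_iff t_def
    by simp_all
  have u: "u x \<in> U" "f (u x) = f x" if "x \<in> X" for x
    using U that theI'[of "\<lambda>t. t \<in> U \<and> f t = f x"] unfolding cross_section_kernel_iff u_def
    by simp_all
  have sub: "x \<in> T \<Longrightarrow> x \<in> X" "x \<in> U \<Longrightarrow> x \<in> X" for x
    using T U by (auto simp: cross_section_kernel_iff)
  have uniqT: "x = y" if "x \<in> T" "y \<in> T" "f x = f y" for x y
    using T that sub(1)[of y] unfolding cross_section_kernel_iff by blast
  have uniqU: "x = y" if "x \<in> U" "y \<in> U" "f x = f y" for x y
    using U that sub(2)[of y] unfolding cross_section_kernel_iff by blast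
  have tu: "t x \<in> T" "t x \<in> X" "t x \<notin> U" "u (t x) = x" if "x \<in> X" "x \<notin> T" "x \<in> U" for x
  proof -
    show "t x \<in> T" "t x \<in> X"
      using t(1) sub(1) that(1) by simp_all
    then show "t x \<notin> U"
      using uniqU[of "t x" x] t(2) that by metis
    show "u (t x) = x"
      using uniqU[of "u (t x)" x] u[of "t x"] t(2)[of x] \<open>t x \<in> X\<close> that by simp
  qed
  have ut: "u x \<in> U" "u x \<in> X" "u x \<notin> T" "t (u x) = x" if "x \<in> X" "x \<notin> U" "x \<in> T" for x
  proof -
    show "u x \<in> U" "u x \<in> X"
      using u(1) sub(2) that(1) by simp_all
    then show "u x \<notin> T"
      using uniqT[of "u x" x] u(2) that by metis
    show "t (u x) = x"
      using uniqT[of "t (u x)" x] t[of "u x"] u(2)[of x] \<open>u x \<in> X\<close> that by simp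
  qed
  have "bij_betw (\<lambda>x. if x \<in> U then t x else x) (X - T) (X - U)"
    by (rule bij_betw_byWitness[where f' = "\<lambda>x. if x \<in> T then u x else x"])
      (auto simp: tu ut)
  then show ?thesis
    using card_of_ordIso by blast
qed

lemma collapse_cross_section:
  assumes "cross_section X (kernel_on X f) T"
  shows "collapse X f =o |X - T|"
  unfolding collapse_def
  by (rule card_of_compl_cross_section[OF someI_ex[OF cross_section_kernel_ex] assms])

lemma monoid_full_transf_monoid: "monoid (full_transf_monoid X)"
proof (rule monoidI, unfold full_transf_monoid_def, simp_all)
  show "compose X f g \<in> X \<rightarrow>\<^sub>E X" if "f \<in> X \<rightarrow>\<^sub>E X" "g \<in> X \<rightarrow>\<^sub>E X" for f g
    using that by (auto simp: compose_def)
  show "compose X h (compose X g f) = compose X (compose X h g) f"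
    if "f \<in> X \<rightarrow>\<^sub>E X" "g \<in> X \<rightarrow>\<^sub>E X" "h \<in> X \<rightarrow>\<^sub>E X" for f g h
    using that compose_assoc[of f X X h g] by auto
qed (auto simp: PiE_def)

lemma Units_full_transf_monoid: "Units (full_transf_monoid X) = Bij X"
proof (intro equalityI subsetI)
  fix u assume "u \<in> Units (full_transf_monoid X)"
  then obtain v where uv: "u \<in> X \<rightarrow>\<^sub>E X" "v \<in> X \<rightarrow>\<^sub>E X"
      "compose X v u = (\<lambda>x\<in>X. x)" "compose X u v = (\<lambda>x\<in>X. x)"
    by (auto simp: Units_def full_transf_monoid_def)
  have "v (u x) = x" "u (v x) = x" if "x \<in> X" for x
    using that fun_cong[OF uv(3), of x] fun_cong[OF uv(4), of x] by (auto simp: compose_def)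
  then have "bij_betw u X X"
    using uv(1,2) by (intro bij_betw_byWitness[where f' = v]) auto
  then show "u \<in> Bij X"
    using uv(1) by (auto simp: Bij_def PiE_def)
next
  fix u assume u: "u \<in> Bij X"
  let ?v = "restrict (inv_into X u) X"
  have v: "?v \<in> Bij X"
    using u by (rule restrict_inv_into_Bij)
  have "compose X ?v u = (\<lambda>x\<in>X. x)"
    using u by (rule Bij_compose_restrict_eq)
  moreover have "compose X u ?v = (\<lambda>x\<in>X. x)"
    using u by (intro ext)
      (simp add: compose_def Bij_def bij_betw_def restrict_def f_inv_into_f)
  moreover have "u \<in> X \<rightarrow>\<^sub>E X" "?v \<in> X \<rightarrow>\<^sub>E X"
    unfolding PiE_def
    using Bij_imp_funcset[OF u] Bij_imp_extensional[OF u] Bij_imp_funcset[OF v]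
      Bij_imp_extensional[OF v] by blast+
  ultimately show "u \<in> Units (full_transf_monoid X)"
    unfolding Units_def full_transf_monoid_def by (simp, blast)
qed

end

theory Submission
  imports Defs
begin

text \<open>
  If \<open>f u f = f\<close> with \<open>u\<close> a unit, then \<open>u\<close> maps the image of \<open>f\<close> onto a cross-section \<open>T\<close> of the
  kernel of \<open>f\<close>, and hence the complement of the image onto the complement of \<open>T\<close>. Conversely,
  the inverse of the bijection that \<open>f\<close> induces from a cross-section \<open>T\<close> onto its image extends to
  a unit by any bijection between the two complements.
\<close>

lemma unit_regular_full_transf_monoid_iff:
  assumes f: "f \<in> X \<rightarrow>\<^sub>E X"
  shows "unit_regular (full_transf_monoid X) f \<longleftrightarrow> (\<exists>u\<in>Bij X. \<forall>x\<in>X. f (u (f x)) = f x)"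
proof -
  \<comment> \<open>The left side is the product \<open>f u f\<close>, as \<open>compose\<close>
    takes the map applied first as its last argument. Both sides are \<open>undefined\<close>
    outside \<open>X\<close>, so only points of \<open>X\<close> need comparing.\<close>
  have "compose X f (compose X u f) = f \<longleftrightarrow> (\<forall>x\<in>X. f (u (f x)) = f x)" for u
    using f by (auto simp: fun_eq_iff compose_def PiE_def extensional_def)
  then show ?thesis
    unfolding unit_regular_def Units_full_transf_monoid by (simp add: full_transf_monoid_def)
qed

lemma cross_section_kernel_bij_betw:
  assumes T: "cross_section X (kernel_on X f) T"
  shows "bij_betw f T (f ` X)"
  unfolding bij_betw_def
proof
  have sub: "T \<subseteq> X" and ex1: "\<And>x. x \<in> X \<Longrightarrow> \<exists>!t. t \<in> T \<and> f t = f x"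
    using T by (auto simp: cross_section_kernel_iff)
  show "inj_on f T"
  proof (rule inj_onI)
    fix x y assume "x \<in> T" "y \<in> T" "f x = f y"
    then show "x = y"
      using ex1[of y] sub by blast
  qed
  show "f ` T = f ` X"
  proof
    show "f ` T \<subseteq> f ` X"
      using sub by blast
    show "f ` X \<subseteq> f ` T"
    proof clarify
      fix x assume "x \<in> X"
      then obtain t where "t \<in> T" "f t = f x"
        using ex1 by blast
      then show "f x \<in> f ` T"
        by (metis imageI)
    qed
  qed
qed

text \<open>Each \<open>u (f y)\<close> lies in the kernel class of \<open>y\<close>, and it depends
  only on \<open>f y\<close>, that is, on the class.\<close>

lemma cross_section_kernel_image:
  assumes "u ` f ` X \<subseteq> X" and fuf: "\<And>x. x \<in> X \<Longrightarrow> f (u (f x)) = f x"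
  shows "cross_section X (kernel_on X f) (u ` f ` X)"
  unfolding cross_section_kernel_iff
proof (intro conjI ballI)
  fix x assume x: "x \<in> X"
  show "\<exists>!t. t \<in> u ` f ` X \<and> f t = f x"
  proof (rule ex1I)
    show "u (f x) \<in> u ` f ` X \<and> f (u (f x)) = f x"
      using x fuf by simp
    show "t = u (f x)" if "t \<in> u ` f ` X \<and> f t = f x" for t
      using that fuf by auto
  qed
qed (fact assms(1))

theorem theorem3p4:
  fixes X :: "'a set" and f :: "'a \<Rightarrow> 'a"
  assumes "X \<noteq> {}" and "f \<in> carrier (full_transf_monoid X)"
  shows "unit_regular (full_transf_monoid X) f \<longleftrightarrow> semi_balanced X f"
proof -
  have f: "f \<in> X \<rightarrow>\<^sub>E X"
    using assms(2) by (simp add: full_transf_monoid_def)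
  then have fX: "f ` X \<subseteq> X"
    by auto
  show ?thesis
    unfolding unit_regular_full_transf_monoid_iff[OF f]
  proof
    assume "\<exists>u\<in>Bij X. \<forall>x\<in>X. f (u (f x)) = f x"
    then obtain u where u: "bij_betw u X X" and fuf: "\<And>x. x \<in> X \<Longrightarrow> f (u (f x)) = f x"
      by (auto simp: Bij_def)
    let ?T = "u ` f ` X"
    have "?T \<subseteq> X"
      using image_mono[OF fX, of u] bij_betw_imp_surj_on[OF u] by simp
    then have T: "cross_section X (kernel_on X f) ?T"
      using fuf by (rule cross_section_kernel_image)
    \<comment> \<open>Being injective, \<open>u\<close> commutes with set difference, and it maps
      \<open>X\<close> onto \<open>X\<close>.\<close>
    have "bij_betw u (X - f ` X) (X - ?T)"
      using bij_betw_subset[OF u, of "X - f ` X"] fX u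
      by (simp add: bij_betw_def inj_on_image_set_diff[of u X])
    then have "|X - ?T| =o |X - f ` X|"
      using card_of_ordIso ordIso_symmetric by blast
    then show "semi_balanced X f"
      unfolding semi_balanced_def defect_def
      using collapse_cross_section[OF T] ordIso_transitive by blast
  next
    assume sb: "semi_balanced X f"
    obtain T where T: "cross_section X (kernel_on X f) T"
      using cross_section_kernel_ex by blast
    then have "T \<subseteq> X"
      by (simp add: cross_section_def)
    \<comment> \<open>The collapse does not depend on the cross-section, so any \<open>T\<close> may
      stand in for the one chosen in its definition.\<close>
    have "|X - f ` X| =o |X - T|"
      using sb collapse_cross_section[OF T] ordIso_symmetric ordIso_transitive
      unfolding semi_balanced_def defect_def by blast
    then obtain g where g: "bij_betw g (X - f ` X) (X - T)"
      using card_of_ordIso by blast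
    note bij = cross_section_kernel_bij_betw[OF T]
    define h where "h y = (if y \<in> f ` X then inv_into T f y else g y)" for y
    have "bij_betw h (f ` X) T"
      using bij_betw_inv_into[OF bij] by (rule bij_betw_cong[THEN iffD1, rotated]) (simp add: h_def)
    moreover have "bij_betw h (X - f ` X) (X - T)"
      using g by (rule bij_betw_cong[THEN iffD1, rotated]) (simp add: h_def)
    ultimately have "bij_betw h (f ` X \<union> (X - f ` X)) (T \<union> (X - T))"
      by (rule bij_betw_combine) auto
    then have "bij_betw h X X"
      using fX \<open>T \<subseteq> X\<close> by (simp add: Un_absorb1)
    \<comment> \<open>Restriction supplies the extensionality that \<open>Bij\<close>
      demands.\<close>
    then have "restrict h X \<in> Bij X"
      by (simp add: Bij_def)
    \<comment> \<open>On the image, \<open>h\<close> picks the preimage lying in \<open>T\<close>,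
      so applying \<open>f\<close> afterwards returns the point; \<open>g\<close> serves only to
      make \<open>h\<close> bijective.\<close>
    moreover have "f (restrict h X (f x)) = f x" if "x \<in> X" for x
      using that fX bij_betw_inv_into_right[OF bij, of "f x"] by (auto simp: h_def)
    ultimately show "\<exists>u\<in>Bij X. \<forall>x\<in>X. f (u (f x)) = f x"
      by blast
  qed
qed

end
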